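(* Let $c>0$ be a fixed constant, let $\xi(n)$ be a real-valued function (of arbitrary sign) with $\xi(n) = o\left(\frac{\log n}{n}\right)$ as $n\to\infty$, and let $p = p(n) = \frac{c\log n}{n} + \xi(n)$. Let $G$ be the random ordered directed graph on vertices $v_1,\dots,v_n$ in which, for each pair $i<j$, the directed edge $(v_i,v_j)$ is present independently with probability $p$ (and there are no other edges). Let $\mathcal{R}$ be the set of vertices reachable from $v_1$ by a directed path in $G$. Then, as $n\to\infty$: 1. If $c<1$, then $|\mathcal{R}| = n^{c+o(1)}$ a.a.s. 2. If $c=1$, then $|\mathcal{R}| = o(n)$ a.a.s. 3. If $c>1$, then $|\mathcal{R}| = \left(1-\frac{1}{c}+o(1)\right)n$ a.a.s.
   Context: $\log$ is the natural logarithm. For all sufficiently large $n$ one has $p(n)\in(0,1)$, and the statement is asymptotic as $n\to\infty$. The vertex $v_1$ is regarded as reachable from itself. An event (depending on $n$) holds a.a.s. (asymptotically almost surely) if its probability is $1-o(1)$ as $n\to\infty$. The $o(\cdot)$ terms inside a.a.s. statements are deterministic bounds, i.e.: item 1 means there is a deterministic sequence $\varepsilon_n\to 0$ with $\mathbb{P}\left(n^{c-\varepsilon_n}\le|\mathcal{R}|\le n^{c+\varepsilon_n}\right)\to 1$; item 2 means there is a deterministic sequence $\varepsilon_n\to0$ with $\mathbb{P}(|\mathcal{R}|\le\varepsilon_n n)\to1$; item 3 means there is a deterministic sequence $\varepsilon_n\to 0$ with $\mathbb{P}\left(\left||\mathcal{R}|-(1-\frac1c)n\right|\le\varepsilon_n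 n\right)\to1$. *)

theory Defs
  imports
    "HOL-Probability.Probability"
    "HOL-Library.Landau_Symbols"
    "Graph_Theory.Pair_Digraph"
begin

text \<open>
  The vertex \<open>v\<^sub>i\<close> is the number \<open>i\<close>. Note that \<^const>\<open>bernoulli_pmf\<close> clamps its parameter to
  \<open>[0, 1]\<close>, so the definition below has its intended meaning only for \<open>0 \<le> p \<le> 1\<close>. Asymptotic
  statements are not affected if this holds for all sufficiently large \<open>n\<close>.
\<close>

definition ordered_pairs :: "nat \<Rightarrow> (nat \<times> nat) set" where
  "ordered_pairs n = {(i, j). 1 \<le> i \<and> i < j \<and> j \<le> n}"

definition random_ordered_digraph :: "nat \<Rightarrow> real \<Rightarrow> nat pair_pre_digraph pmf" where
  "random_ordered_digraph n p =
     map_pmf (\<lambda>X. \<lparr>pverts = {1..n}, parcs = {e \<in> ordered_pairs n. X e}\<rparr>)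
       (Pi_pmf (ordered_pairs n) False (\<lambda>_. bernoulli_pmf p))"

text \<open>
  The library's reachability relation is reflexive on the vertices, so every vertex belongs to its
  own reachable set.
\<close>

definition reachable_set :: "nat pair_pre_digraph \<Rightarrow> nat \<Rightarrow> nat set" where
  "reachable_set G v = {w. v \<rightarrow>\<^sup>*\<^bsub>with_proj G\<^esub> w}"

definition aas :: "(nat \<Rightarrow> 'a pmf) \<Rightarrow> (nat \<Rightarrow> 'a \<Rightarrow> bool) \<Rightarrow> bool" where
  "aas M P \<longleftrightarrow> (\<lambda>n. measure_pmf.prob (M n) {x. P n x}) \<longlonglongrightarrow> 1"

end

theory Submission
  imports Defs "HOL-Real_Asymp.Real_Asymp"
begin

text \<open>
  Reveal the vertices in increasing order. Since every edge points upwards, vertex \<open>n + 1\<close> is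
  reachable exactly if one of the edges into it starts at a vertex that is already known to be
  reachable. Hence the number \<open>X\<^sub>n\<close> of reachable vertices among the first \<open>n\<close> is a Markov chain
  that starts in \<open>1\<close> and moves from \<open>x\<close> to \<open>x + 1\<close> with probability \<open>1 - q\<^sup>x\<close>, where
  \<open>q = 1 - p\<close> (\<open>reach_count_Suc\<close>). The rest of the proof is about this chain only.

  If one step of the chain multiplies the mean of \<open>g\<close> by at most \<open>\<rho>\<close>, whatever the current state,
  then \<open>E (g X\<^sub>n) \<le> \<rho>\<^bsup>n - 1\<^esup> g 1\<close> (\<open>expectation_reach_count_le\<close>), and Markov's inequality turns
  this into a tail bound. Two choices of \<open>g\<close> suffice.

  For the upper tail, \<open>g x = q\<^bsup>-x\<^esup> - 1\<close> is multiplied by exactly \<open>1 / q\<close>, so that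
  \<open>E (q\<^bsup>-X\<^esup> - 1) = p q\<^bsup>-n\<^esup>\<close>. As \<open>q\<^bsup>-n\<^esup> = n\<^bsup>c + o(1)\<^esup>\<close>, the quantity \<open>q\<^bsup>-X\<^esup> - 1\<close> is at most
  \<open>n\<^bsup>c - 1 + o(1)\<^esup>\<close> with high probability. For \<open>c < 1\<close> this is small and linearises to
  \<open>p X \<le> n\<^bsup>c - 1 + o(1)\<^esup>\<close>, that is, \<open>X \<le> n\<^bsup>c + o(1)\<^esup>\<close>. For \<open>c \<ge> 1\<close>, taking logarithms gives
  \<open>(c ln n / n) X \<le> (c - 1 + o(1)) ln n\<close>, that is, \<open>X \<le> (1 - 1 / c + o(1)) n\<close>.

  For the lower tail the natural candidate is the reciprocal \<open>1 / (q\<^bsup>-x\<^esup> - 1)\<close>, which should decay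
  at rate \<open>p\<close>. No positive function decays faster than that, because the chain stays in \<open>1\<close> with
  probability \<open>1 - p\<close> in each step, and the candidate itself misses this rate, most noticeably in
  the first few states. A square root of the candidate decays only at rate \<open>p / 2\<close>, which leaves enough room to
  treat the state \<open>1\<close> separately (\<open>lower_weight\<close>). The tail bound obtained in this way is the square
  root of the expected one, which still tends to \<open>0\<close>.

  Both tails are bounded for every fixed slack \<open>\<delta> > 0\<close> in the exponent or in the linear
  coefficient; \<open>exists_vanishing_slack\<close> replaces \<open>\<delta>\<close> by a sequence that tends to \<open>0\<close>.
\<close>

section \<open>The reachable vertices as a Markov chain\<close>

abbreviation ordered_digraph :: "nat \<Rightarrow> (nat \<times> nat \<Rightarrow> bool) \<Rightarrow> nat pair_pre_digraph" where
  "ordered_digraph n X \<equiv> \<lparr>pverts = {1..n}, parcs = {e \<in> ordered_pairs n. X e}\<rparr>"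

text \<open>
  The set is written as a function of the edge indicators \<open>X\<close>, which are independent, and all
  graphs can be read off the same \<open>X\<close>; this makes the sets for \<open>n\<close> and \<open>n + 1\<close> comparable.
\<close>

definition reached :: "nat \<Rightarrow> (nat \<times> nat \<Rightarrow> bool) \<Rightarrow> nat set" where
  "reached n X = reachable_set (ordered_digraph n X) 1"

lemma reached_altdef:
  "reached n X = {w. (1, w) \<in> rtrancl_on {1..n} {e \<in> ordered_pairs n. X e}}"
  by (simp add: reached_def reachable_set_def reachable_def)

lemma reached_subset: "reached n X \<subseteq> {1..n}"
  unfolding reached_altdef using in_rtrancl_on_in_F by fastforce

lemma finite_reached [simp]: "finite (reached n X)"
  using reached_subset by (rule finite_subset) simp

lemma one_in_reached: "n \<ge> 1 \<Longrightarrow> 1 \<in> reached n X"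
  by (simp add: reached_altdef)

lemma reached_cong:
  assumes "\<And>e. e \<in> ordered_pairs n \<Longrightarrow> X e = Y e"
  shows "reached n X = reached n Y"
proof -
  have "{e \<in> ordered_pairs n. X e} = {e \<in> ordered_pairs n. Y e}"
    using assms by auto
  then show ?thesis by (simp add: reached_def)
qed

lemma reached_1: "reached 1 X = {1}"
  using reached_subset[of 1 X] one_in_reached[of 1 X] by auto

text \<open>
  The new vertex has no outgoing edges, so it cannot help to reach a smaller one, and the last edge
  of a path to it starts at a reachable vertex that is at most \<open>n\<close>.
\<close>

lemma reached_Suc:
  assumes "n \<ge> 1"
  shows "reached (Suc n) X =
    (if \<exists>i\<in>reached n X. X (i, Suc n) then insert (Suc n) (reached n X) else reached n X)"
    (is "_ = ?R")
proof (intro equalityI subsetI)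
  fix w assume "w \<in> reached (Suc n) X"
  then have "(1, w) \<in> rtrancl_on {1..Suc n} {e \<in> ordered_pairs (Suc n). X e}"
    by (simp add: reached_altdef)
  then show "w \<in> ?R"
  proof (induction rule: rtrancl_on_induct)
    case base
    then show ?case using one_in_reached[OF assms, of X] by auto
  next
    case (step y z)
    from step have yz: "1 \<le> y" "y < z" "z \<le> Suc n" "X (y, z)"
      by (auto simp: ordered_pairs_def)
    then have y: "y \<in> reached n X"
      using step.IH by (auto split: if_splits)
    show ?case
    proof (cases "z = Suc n")
      case True
      then show ?thesis using y yz by auto
    next
      case False
      then have "(y, z) \<in> {e \<in> ordered_pairs n. X e}" "z \<in> {1..n}"
        using yz by (auto simp: ordered_pairs_def)
      then have "z \<in> reached n X"
        using y unfolding reached_altdef by (auto intro: rtrancl_on_into_rtrancl_on)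
      then show ?thesis by auto
    qed
  qed
next
  fix w assume w: "w \<in> ?R"
  have sub: "reached n X \<subseteq> reached (Suc n) X"
  proof
    fix v assume "v \<in> reached n X"
    then have "(1, v) \<in> rtrancl_on {1..n} {e \<in> ordered_pairs n. X e}"
      by (simp add: reached_altdef)
    then have "(1, v) \<in> rtrancl_on {1..Suc n} {e \<in> ordered_pairs (Suc n). X e}"
      by (rule rtrancl_on_mono[rotated 2]) (auto simp: ordered_pairs_def)
    then show "v \<in> reached (Suc n) X" by (simp add: reached_altdef)
  qed
  show "w \<in> reached (Suc n) X"
  proof (cases "w \<in> reached n X")
    case True
    then show ?thesis using sub by auto
  next
    case False
    with w obtain i where i: "i \<in> reached n X" "X (i, Suc n)" "w = Suc n"
      by (auto split: if_splits)
    then have "(i, Suc n) \<in> {e \<in> ordered_pairs (Suc n). X e}"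
      using reached_subset[of n X] by (auto simp: ordered_pairs_def)
    moreover have "(1, i) \<in> rtrancl_on {1..Suc n} {e \<in> ordered_pairs (Suc n). X e}"
      using i sub by (auto simp: reached_altdef)
    ultimately show ?thesis
      using i by (auto simp: reached_altdef intro: rtrancl_on_into_rtrancl_on)
  qed
qed

lemma map_pmf_Ex_Pi_bernoulli:
  assumes "finite A" "B \<subseteq> A" "0 \<le> p" "p \<le> 1"
  shows "map_pmf (\<lambda>g. \<exists>x\<in>B. g x) (Pi_pmf A False (\<lambda>_. bernoulli_pmf p)) =
    bernoulli_pmf (1 - (1 - p) ^ card B)"
    (is "?L = ?R")
proof -
  have B: "finite B" using assms finite_subset by auto
  have q: "0 \<le> (1 - p) ^ card B" "(1 - p) ^ card B \<le> 1"
    using assms by (auto intro: power_le_one)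
  have "pmf ?L False = measure_pmf.prob (Pi_pmf A False (\<lambda>_. bernoulli_pmf p))
      (Pi A (\<lambda>x. if x \<in> B then {False} else UNIV))"
    unfolding pmf_map using assms(2)
    by (intro arg_cong[of _ _ "measure_pmf.prob _"]) (auto simp: Pi_def)
  also have "\<dots> = (\<Prod>x\<in>A. measure_pmf.prob (bernoulli_pmf p) (if x \<in> B then {False} else UNIV))"
    using assms by (intro measure_Pi_pmf_Pi)
  also have "\<dots> = (\<Prod>x\<in>A. if x \<in> B then 1 - p else 1)"
    using assms by (intro prod.cong) (auto simp: measure_pmf_single)
  also have "\<dots> = (1 - p) ^ card B"
    using assms by (simp add: prod.If_cases Int_absorb1)
  finally have F: "pmf ?L False = pmf ?R False"
    using q by simp
  moreover have "pmf ?L True = pmf ?R True"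
    using pmf_False_conv_True[of ?L] pmf_False_conv_True[of ?R] F by simp
  ultimately show ?thesis
    by (intro pmf_eqI) (metis (full_types))
qed

text \<open>The law of \<open>X\<^sub>n\<close>, the state of the chain at time \<open>n\<close>.\<close>

definition reach_count :: "nat \<Rightarrow> real \<Rightarrow> nat pmf" where
  "reach_count n p = map_pmf (\<lambda>G. card (reachable_set G 1)) (random_ordered_digraph n p)"

lemma finite_ordered_pairs [simp]: "finite (ordered_pairs n)"
proof (rule finite_subset)
  show "ordered_pairs n \<subseteq> {1..n} \<times> {1..n}"
    by (auto simp: ordered_pairs_def)
qed simp

lemma reach_count_altdef:
  "reach_count n p = map_pmf (\<lambda>X. card (reached n X))
     (Pi_pmf (ordered_pairs n) False (\<lambda>_. bernoulli_pmf p))"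
  by (simp add: reach_count_def random_ordered_digraph_def map_pmf_comp reached_def)

lemma set_reach_count: "n \<ge> 1 \<Longrightarrow> set_pmf (reach_count n p) \<subseteq> {1..n}"
proof -
  assume n: "n \<ge> 1"
  have "card (reached n X) \<in> {1..n}" for X
    using card_mono[OF _ reached_subset[of n X]] one_in_reached[OF n, of X]
    by (auto simp: Suc_le_eq card_gt_0_iff)
  then show ?thesis by (auto simp: reach_count_altdef)
qed

lemma reach_count_1: "reach_count 1 p = return_pmf 1"
  by (simp only: reach_count_altdef reached_1) (simp add: map_pmf_const)

text \<open>
  The reachable set for \<open>n\<close> is a function of the edges among the first \<open>n\<close> vertices. These are
  independent of the edges into vertex \<open>n + 1\<close>, so only the size of that set matters for the
  probability that one of its elements sends an edge to \<open>n + 1\<close>.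
\<close>

lemma reach_count_Suc:
  assumes "n \<ge> 1" "0 \<le> p" "p \<le> 1"
  shows "reach_count (Suc n) p =
    bind_pmf (reach_count n p)
      (\<lambda>x. map_pmf (\<lambda>b. if b then Suc x else x) (bernoulli_pmf (1 - (1 - p) ^ x)))"
proof -
  define A where "A = ordered_pairs n"
  define B where "B = (\<lambda>i. (i, Suc n)) ` {1..n}"
  define P where "P = (\<lambda>S :: (nat \<times> nat) set. Pi_pmf S False (\<lambda>_. bernoulli_pmf p))"
  have AB: "finite A" "finite B"
      "A \<inter> B = {}" "ordered_pairs (Suc n) = A \<union> B"
    using finite_ordered_pairs[of n] unfolding A_def B_def
    by (auto simp: image_iff) (auto simp: ordered_pairs_def)
  have card: "card (reached (Suc n) (\<lambda>e. if e \<in> A then f e else g e)) =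
      (if \<exists>e\<in>(\<lambda>i. (i, Suc n)) ` reached n f. g e then Suc (card (reached n f))
       else card (reached n f))" for f g
  proof -
    have "reached n (\<lambda>e. if e \<in> A then f e else g e) = reached n f"
      by (rule reached_cong) (simp add: A_def)
    moreover have "(i, Suc n) \<notin> A" for i
      by (auto simp: A_def ordered_pairs_def)
    moreover have "Suc n \<notin> reached n f"
      using reached_subset[of n f] by auto
    ultimately show ?thesis
      by (simp add: reached_Suc[OF assms(1)])
  qed
  have new: "map_pmf (\<lambda>g. \<exists>e\<in>(\<lambda>i. (i, Suc n)) ` reached n f. g e) (P B) =
      bernoulli_pmf (1 - (1 - p) ^ card (reached n f))" for f
  proof -
    have "card ((\<lambda>i. (i, Suc n)) ` reached n f) = card (reached n f)"
      by (intro card_image) (auto simp: inj_on_def)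
    then show ?thesis
      unfolding P_def using assms AB reached_subset[of n f]
      by (subst map_pmf_Ex_Pi_bernoulli) (auto simp: B_def)
  qed
  have "reach_count (Suc n) p = map_pmf (\<lambda>(f, g).
      if \<exists>e\<in>(\<lambda>i. (i, Suc n)) ` reached n f. g e then Suc (card (reached n f))
       else card (reached n f)) (pair_pmf (P A) (P B))"
    unfolding reach_count_altdef AB(4) P_def Pi_pmf_union[OF AB(1-3)] map_pmf_comp
    by (intro map_pmf_cong refl) (auto simp only: card split: prod.splits)
  also have "\<dots> = bind_pmf (P A) (\<lambda>f.
      map_pmf (\<lambda>b. if b then Suc (card (reached n f)) else card (reached n f))
        (map_pmf (\<lambda>g. \<exists>e\<in>(\<lambda>i. (i, Suc n)) ` reached n f. g e) (P B)))"
    by (simp add: pair_pmf_def map_bind_pmf map_pmf_comp map_pmf_def[symmetric] bind_return_pmf'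
        bind_assoc_pmf bind_return_pmf)
  also have "\<dots> = bind_pmf (reach_count n p)
      (\<lambda>x. map_pmf (\<lambda>b. if b then Suc x else x) (bernoulli_pmf (1 - (1 - p) ^ x)))"
    unfolding new by (simp add: reach_count_altdef P_def A_def bind_map_pmf)
  finally show ?thesis .
qed

section \<open>Tail bounds\<close>

lemma expectation_reach_count_le:
  fixes g :: "nat \<Rightarrow> real"
  assumes "n \<ge> 1" "0 \<le> p" "p \<le> 1" "\<rho> \<ge> 0"
    and "\<And>x. x \<ge> 1 \<Longrightarrow> (1 - (1 - p) ^ x) * g (Suc x) + (1 - p) ^ x * g x \<le> \<rho> * g x"
  shows "measure_pmf.expectation (reach_count n p) g \<le> \<rho> ^ (n - 1) * g 1"
  using assms(1)
proof (induction n rule: dec_induct)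
  case base
  show ?case unfolding reach_count_1 by simp
next
  case (step n)
  let ?K = "\<lambda>x. map_pmf (\<lambda>b. if b then Suc x else x) (bernoulli_pmf (1 - (1 - p) ^ x))"
  let ?P = "reach_count n p"
  have q: "0 \<le> (1 - p) ^ x" "(1 - p) ^ x \<le> 1" for x
    using assms by (auto intro: power_le_one)
  have "measure_pmf.expectation (reach_count (Suc n) p) g =
      (\<Sum>x\<in>{1..n}. pmf ?P x * measure_pmf.expectation (?K x) g)"
    unfolding reach_count_Suc[OF step.hyps(1) assms(2,3)]
    using set_reach_count[OF step.hyps(1)] by (subst pmf_expectation_bind[of "{1..n}"]) auto
  also have "\<dots> \<le> (\<Sum>x\<in>{1..n}. pmf ?P x * (\<rho> * g x))"
  proof (intro sum_mono mult_left_mono)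
    fix x assume "x \<in> {1..n}"
    then show "measure_pmf.expectation (?K x) g \<le> \<rho> * g x"
      using assms(5)[of x] q[of x] by (simp add: mult_ac)
  qed auto
  also have "\<dots> = \<rho> * measure_pmf.expectation ?P g"
    using set_reach_count[OF step.hyps(1), of p]
    by (subst integral_measure_pmf[of "{1..n}"])
      (auto simp: sum_distrib_left mult_ac dest: subsetD)
  also have "\<dots> \<le> \<rho> * (\<rho> ^ (n - 1) * g 1)"
    using step.IH assms(4) by (rule mult_left_mono)
  also have "\<dots> = \<rho> ^ (Suc n - 1) * g 1"
    using step.hyps(1) by (cases n) auto
  finally show ?case .
qed

lemma power_eq_exp_ln:
  fixes p :: real
  assumes "p < 1"
  shows "(1 - p) ^ k = exp (ln (1 - p) * real k)"
  using assms by (simp add: exp_of_nat2_mult)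

lemma prob_reach_count_le:
  fixes g :: "nat \<Rightarrow> real"
  assumes "n \<ge> 1" "\<And>k. k \<ge> 1 \<Longrightarrow> g k \<ge> 0" "a > 0"
    and "\<And>k. k \<ge> 1 \<Longrightarrow> P k \<Longrightarrow> g k \<ge> a"
  shows "measure_pmf.prob (reach_count n p) {k. P k} \<le>
    measure_pmf.expectation (reach_count n p) g / a"
proof -
  let ?M = "reach_count n p"
  have AE: "AE k in ?M. k \<ge> 1"
    using set_reach_count[OF assms(1), of p] by (auto simp: AE_measure_pmf_iff dest: subsetD)
  have "measure_pmf.prob ?M {k. P k} \<le> measure_pmf.prob ?M {k \<in> space ?M. g k \<ge> a}"
    using AE by (intro measure_pmf.finite_measure_mono_AE) (auto elim!: eventually_mono intro: assms)
  also have "\<dots> \<le> measure_pmf.expectation ?M g / a"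
  proof (rule integral_Markov_inequality_measure)
    show "integrable ?M g"
      using set_reach_count[OF assms(1), of p]
      by (intro integrable_measure_pmf_finite) (auto intro: finite_subset)
    show "AE k in ?M. 0 \<le> g k"
      using AE by eventually_elim (use assms in auto)
  qed (use assms in auto)
  finally show ?thesis .
qed

text \<open>
  Markov's inequality for \<open>q\<^bsup>-k\<^esup> - 1\<close> with \<open>q = 1 - p\<close>. Powers of \<open>q\<close> are written as exponentials
  because the threshold \<open>x\<close> need not be an integer.
\<close>

lemma prob_reach_count_gt:
  assumes "n \<ge> 1" "0 < p" "p < 1" "x > 0"
  defines "s \<equiv> - ln (1 - p)"
  shows "measure_pmf.prob (reach_count n p) {k. real k > x} \<le>
    p * exp (s * n) / (exp (s * x) - 1)"
proof -
  define q where "q = 1 - p"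
  have q: "0 < q" "q < 1" using assms by (auto simp: q_def)
  have s: "s > 0" using assms by (simp add: s_def)
  have qk: "1 / q ^ k = exp (s * real k)" for k
    using power_eq_exp_ln[of p k] assms by (simp add: q_def s_def exp_minus inverse_eq_divide)
  define g where "g k = 1 / q ^ k - 1" for k
  have "measure_pmf.expectation (reach_count n p) g \<le> (1 / q) ^ (n - 1) * g 1"
  proof (rule expectation_reach_count_le)
    fix k :: nat
    \<comment> \<open>This is an equality: both sides are \<open>(1 - q\<^sup>k) / q\<^bsup>k + 1\<^esup>\<close>.\<close>
    show "(1 - (1 - p) ^ k) * g (Suc k) + (1 - p) ^ k * g k \<le> 1 / q * g k"
      using q unfolding g_def q_def[symmetric] by (simp add: field_simps)
  qed (use assms q in auto)
  also have "\<dots> = p * (1 / q ^ n)"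
    using assms(1) q by (cases n) (auto simp: g_def q_def field_simps)
  finally have E: "measure_pmf.expectation (reach_count n p) g \<le> p * exp (s * n)"
    by (simp only: qk)
  have "measure_pmf.prob (reach_count n p) {k. real k > x} \<le>
      measure_pmf.expectation (reach_count n p) g / (exp (s * x) - 1)"
    using s assms(1,4) by (intro prob_reach_count_le) (auto simp: g_def qk)
  also have "\<dots> \<le> p * exp (s * n) / (exp (s * x) - 1)"
    using E s assms(4) by (intro divide_right_mono) auto
  finally show ?thesis .
qed

text \<open>
  With \<open>q = 1 - p\<close>, the radicand is \<open>(p / q) / (q\<^bsup>-(k - 1)\<^esup> - 1)\<close>, the reciprocal of the function used
  for the upper tail, shifted by one. The shift makes the quotient of the radicands at \<open>k + 1\<close> and
  \<open>k\<close> equal to \<open>1 - p / (1 - q\<^sup>k)\<close>; as the step is made with probability \<open>1 - q\<^sup>k\<close>, the radicand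
  decays at rate exactly \<open>p\<close> from \<open>k = 2\<close> on. At \<open>k = 1\<close> it has a pole. The value \<open>2\<close> there is the
  least one for which the square root decays at rate \<open>p / 2\<close> in the state \<open>1\<close> as well, since the
  value in the state \<open>2\<close> is \<open>1\<close>.
\<close>

definition lower_weight :: "real \<Rightarrow> nat \<Rightarrow> real" where
  "lower_weight p k =
    (if k \<le> 1 then 2 else sqrt (p * (1 - p) ^ (k - 2) / (1 - (1 - p) ^ (k - 1))))"

lemma lower_weight_step:
  assumes "0 < p" "p < 1" "k \<ge> 1"
  shows "(1 - (1 - p) ^ k) * lower_weight p (Suc k) + (1 - p) ^ k * lower_weight p k
    \<le> (1 - p / 2) * lower_weight p k"
proof (cases "k = 1")
  case True
  then show ?thesis using assms by (simp add: lower_weight_def field_simps)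
next
  case False
  define q where "q = 1 - p"
  have q: "0 < q" "q < 1" using assms by (auto simp: q_def)
  obtain j where j: "k = Suc (Suc j)"
    using False assms(3) by (metis One_nat_def Suc_le_D not_less_eq_eq le_SucE not0_implies_Suc
        le_zero_eq)
  define t where "t = 1 - q ^ k"
  have t: "p \<le> t" "t > 0"
  proof -
    have "q ^ k \<le> q ^ 1" using q assms(3) by (intro power_decreasing) auto
    then show "p \<le> t" by (simp add: t_def q_def)
    with assms show "t > 0" by simp
  qed
  have r: "p / t \<le> 1" "p / t \<ge> 0" using t assms by auto
  have pos: "1 - q ^ Suc j > 0" using q power_less_one_iff[of q "Suc j"] by simp
  have w: "lower_weight p k = sqrt (p * q ^ j / (1 - q ^ Suc j))"
    by (simp add: lower_weight_def j q_def)
  have "1 - p / t = q * (1 - q ^ Suc j) / t"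
    using t by (simp add: t_def j field_simps) (simp add: q_def algebra_simps)
  then have "p * q ^ Suc j / t = p * q ^ j / (1 - q ^ Suc j) * (1 - p / t)"
    using pos by (simp del: right_diff_distrib left_diff_distrib)
  then have "lower_weight p (Suc k) = lower_weight p k * sqrt (1 - p / t)"
    unfolding w by (simp add: lower_weight_def j q_def t_def real_sqrt_mult[symmetric])
  \<comment> \<open>Concavity of the square root turns the rate \<open>p\<close> of the radicand into the rate \<open>p / 2\<close>.\<close>
  also have "\<dots> \<le> lower_weight p k * (1 - p / t / 2)"
  proof (rule mult_left_mono)
    show "sqrt (1 - p / t) \<le> 1 - p / t / 2"
      using r by (intro real_le_lsqrt) (auto simp: power2_eq_square algebra_simps)
    show "0 \<le> lower_weight p k" using pos q assms unfolding w by simp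
  qed
  finally have "t * lower_weight p (Suc k) \<le> t * (lower_weight p k * (1 - p / t / 2))"
    using t by (intro mult_left_mono) auto
  also have "\<dots> = (t - p / 2) * lower_weight p k"
    using t by (simp add: field_simps)
  finally show ?thesis
    by (simp add: t_def q_def algebra_simps)
qed

text \<open>
  The bound by \<open>p\<close> is the useful one when \<open>k\<close> is of the order of \<open>n\<close>, and the bound by \<open>1 / k\<close>
  when \<open>p k\<close> is small.
\<close>

lemma lower_weight_ge:
  assumes "0 < p" "p < 1" "k \<ge> 1"
  shows "sqrt (max p (1 / real k) * (1 - p) ^ k) \<le> lower_weight p k"
proof (cases "k = 1")
  case True
  have "sqrt (max p 1 * (1 - p)) \<le> 1" using assms by (intro real_le_lsqrt) auto
  also have "\<dots> \<le> (2 :: real)" by simp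
  finally show ?thesis using True by (simp add: lower_weight_def)
next
  case False
  define q where "q = 1 - p"
  have q: "0 < q" "q < 1" using assms by (auto simp: q_def)
  have pos: "1 - q ^ (k - 1) > 0" using q False assms by (simp add: power_less_one_iff)
  \<comment> \<open>The denominator \<open>1 - q\<^bsup>k - 1\<^esup>\<close> is at most \<open>1\<close> and, by Bernoulli's inequality, at most \<open>k p\<close>.\<close>
  have "(1 + (- p)) ^ (k - 1) \<ge> 1 + real (k - 1) * (- p)"
    using assms by (intro Bernoulli_inequality) auto
  then have "1 - q ^ (k - 1) \<le> real (k - 1) * p" by (simp add: q_def)
  also have "\<dots> \<le> real k * p" using assms by (intro mult_right_mono) auto
  finally have u: "1 - q ^ (k - 1) \<le> real k * p" .
  have "max p (1 / real k) \<le> p / (1 - q ^ (k - 1))"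
  proof (rule max.boundedI)
    show "p \<le> p / (1 - q ^ (k - 1))"
      using pos q assms by (simp add: pos_le_divide_eq)
    show "1 / real k \<le> p / (1 - q ^ (k - 1))"
      using pos u assms by (simp add: field_simps)
  qed
  moreover have "q ^ k \<le> q ^ (k - 2)"
    using q by (intro power_decreasing) auto
  ultimately have "max p (1 / real k) * q ^ k \<le> p / (1 - q ^ (k - 1)) * q ^ (k - 2)"
    using q assms pos by (intro mult_mono) auto
  then show ?thesis
    using False assms by (simp add: lower_weight_def q_def)
qed

text \<open>
  Apart from the factor \<open>2 exp (p / 2)\<close>, the bound is the square root of
  \<open>exp (s x - p n) / a\<close>. The parameter \<open>a\<close> selects one of the two lower bounds on the weight.
\<close>

lemma prob_reach_count_lt:
  assumes "n \<ge> 1" "0 < p" "p < 1" "a > 0" "a = p \<or> a = 1 / x"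
  defines "s \<equiv> - ln (1 - p)"
  shows "measure_pmf.prob (reach_count n p) {k. real k < x} \<le>
    2 * exp (p / 2) * exp ((s * x - p * n - ln a) / 2)"
proof -
  have s: "s > 0" using assms by (simp add: s_def)
  have "measure_pmf.prob (reach_count n p) {k. real k < x} \<le>
      measure_pmf.expectation (reach_count n p) (lower_weight p) / exp ((ln a - s * x) / 2)"
  proof (rule prob_reach_count_le)
    fix k :: nat assume k: "k \<ge> 1"
    have "0 \<le> sqrt (max p (1 / real k) * (1 - p) ^ k)" using assms by simp
    also have "\<dots> \<le> lower_weight p k" using assms k by (intro lower_weight_ge) auto
    finally show "lower_weight p k \<ge> 0" .
    assume kx: "real k < x"
    have "exp ((ln a - s * x) / 2) ^ 2 = exp (ln a + (- (s * x)))"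
      by (simp only: power2_eq_square exp_add[symmetric]) simp
    also have "\<dots> = a * exp (- (s * x))"
      using assms(4) by (simp only: exp_add exp_ln)
    finally have "exp ((ln a - s * x) / 2) = sqrt (a * exp (- (s * x)))"
      by (intro real_sqrt_unique[symmetric]) auto
    also have "\<dots> \<le> sqrt (max p (1 / real k) * (1 - p) ^ k)"
    proof (intro real_sqrt_le_mono mult_mono)
      show "a \<le> max p (1 / real k)"
        using assms(5) kx k by (auto simp: le_max_iff_disj frac_le)
      have "exp (- (s * x)) \<le> exp (- (s * real k))" using kx s by simp
      also have "\<dots> = (1 - p) ^ k" using assms by (simp add: power_eq_exp_ln s_def)
      finally show "exp (- (s * x)) \<le> (1 - p) ^ k" .
    qed (use assms in auto)
    also have "\<dots> \<le> lower_weight p k" by fact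
    finally show "lower_weight p k \<ge> exp ((ln a - s * x) / 2)" .
  qed (use assms in auto)
  also have "\<dots> \<le> (2 * exp (p / 2) * exp (- (p * n) / 2)) / exp ((ln a - s * x) / 2)"
  proof (rule divide_right_mono)
    have "measure_pmf.expectation (reach_count n p) (lower_weight p) \<le>
        (1 - p / 2) ^ (n - 1) * lower_weight p 1"
      using assms lower_weight_step[of p] by (intro expectation_reach_count_le) auto
    also have "\<dots> = 2 * (1 - p / 2) ^ (n - 1)" by (simp add: lower_weight_def)
    also have "(1 - p / 2) ^ (n - 1) \<le> exp (- p / 2) ^ (n - 1)"
      using assms exp_ge_add_one_self[of "- p / 2"] by (intro power_mono) auto
    also have "exp (- p / 2) ^ (n - 1) = exp (p / 2) * exp (- (p * n) / 2)"
      using assms(1) by (simp add: exp_of_nat_mult[symmetric] exp_add[symmetric] of_nat_diff field_simps)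
    finally show "measure_pmf.expectation (reach_count n p) (lower_weight p) \<le>
      2 * exp (p / 2) * exp (- (p * n) / 2)" by (simp add: mult_ac)
  qed simp
  also have "\<dots> = 2 * exp (p / 2) * exp (- (p * n) / 2 - (ln a - s * x) / 2)"
    by (simp only: exp_diff times_divide_eq_right)
  also have "- (p * n) / 2 - (ln a - s * x) / 2 = (s * x - p * n - ln a) / 2"
    by (simp add: field_simps)
  finally show ?thesis .
qed

section \<open>Asymptotics of the tails\<close>

text \<open>
  Each tail bound below is brought into this form, so that only the limit of the exponent \<open>b\<close> of
  \<open>n\<close> has to be computed.
\<close>

lemma exp_ln_mult_tendsto_0:
  fixes b :: "nat \<Rightarrow> real"
  assumes "b \<longlonglongrightarrow> l" "l < 0"
  shows "(\<lambda>n. exp (ln (real n) * b n)) \<longlonglongrightarrow> 0"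
proof -
  have "filterlim (\<lambda>n. ln (real n)) at_top sequentially"
    by real_asymp
  then have "filterlim (\<lambda>n. b n * ln (real n)) at_bot sequentially"
    using filterlim_tendsto_neg_mult_at_bot[OF assms] by blast
  then show ?thesis
    by (auto intro!: filterlim_compose[OF exp_at_bot] simp: mult.commute)
qed

lemma tendsto_0_bound:
  fixes f g :: "nat \<Rightarrow> real"
  assumes "\<And>n. 0 \<le> f n" "eventually (\<lambda>n. f n \<le> g n) sequentially" "g \<longlonglongrightarrow> 0"
  shows "f \<longlonglongrightarrow> 0"
  using tendsto_sandwich[of "\<lambda>_. 0" f sequentially g 0] assms by auto

text \<open>
  The two assumptions on \<open>p\<close> in the theorem enter only through this limit.
\<close>

locale edge_probability =
  fixes p :: "nat \<Rightarrow> real" and c :: real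
  assumes c_pos: "c > 0"
    and scaling: "(\<lambda>n. p n * real n / ln (real n)) \<longlonglongrightarrow> c"
begin

text \<open>
  \<open>\<gamma>\<close> and \<open>\<kappa>\<close> rescale \<open>p\<close> and \<open>s = - ln (1 - p)\<close> by \<open>n / ln n\<close>; both tend to \<open>c\<close>. They serve to
  write \<open>exp (p n)\<close> as \<open>n\<^bsup>\<gamma>\<^esup>\<close> and \<open>(1 - p)\<^bsup>-n\<^esup>\<close> as \<open>n\<^bsup>\<kappa>\<^esup>\<close>.
\<close>

definition s :: "nat \<Rightarrow> real" where "s n = - ln (1 - p n)"

definition \<gamma> :: "nat \<Rightarrow> real" where "\<gamma> n = p n * real n / ln (real n)"

definition \<kappa> :: "nat \<Rightarrow> real" where "\<kappa> n = s n * real n / ln (real n)"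

lemma \<gamma>: "\<gamma> \<longlonglongrightarrow> c"
  unfolding \<gamma>_def by (rule scaling)

lemma p_tendsto_0: "p \<longlonglongrightarrow> 0"
proof -
  have "(\<lambda>n. ln (real n) / real n) \<longlonglongrightarrow> 0" by real_asymp
  then have "(\<lambda>n. \<gamma> n * (ln (real n) / real n)) \<longlonglongrightarrow> c * 0"
    by (intro tendsto_mult \<gamma>)
  moreover have "\<forall>\<^sub>F n in sequentially. \<gamma> n * (ln (real n) / real n) = p n"
    using eventually_gt_at_top[of 1] by eventually_elim (simp add: \<gamma>_def)
  ultimately show ?thesis
    using tendsto_cong by force
qed

lemma eventually_parameter_bounds: "\<forall>\<^sub>F n in sequentially. n > 1 \<and> 0 < p n \<and> p n < 1 \<and> 0 < \<gamma> n \<and> 0 < s n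
    \<and> p n \<le> s n"
proof -
  have "\<forall>\<^sub>F n in sequentially. p n < 1" "\<forall>\<^sub>F n in sequentially. \<gamma> n > 0"
    using order_tendstoD(2)[OF p_tendsto_0, of 1] order_tendstoD(1)[OF \<gamma>, of 0] c_pos by auto
  then show ?thesis
    using eventually_gt_at_top[of 1]
  proof eventually_elim
    case (elim n)
    then have "0 < p n" by (auto simp: \<gamma>_def zero_less_mult_iff zero_less_divide_iff)
    moreover have "ln (1 + (- p n)) \<le> - p n"
      using elim by (intro ln_add_one_self_le_self2) auto
    ultimately show ?case using elim by (auto simp: s_def)
  qed
qed

lemma \<kappa>: "\<kappa> \<longlonglongrightarrow> c"
proof -
  have "((\<lambda>x :: real. - ln (1 - x) / x) \<longlongrightarrow> 1) (at_right 0)" by real_asymp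
  moreover have "filterlim p (at_right 0) sequentially"
    unfolding filterlim_at using p_tendsto_0 eventually_parameter_bounds by (auto elim: eventually_mono)
  ultimately have "(\<lambda>n. - ln (1 - p n) / p n) \<longlonglongrightarrow> 1"
    by (rule filterlim_compose)
  then have "(\<lambda>n. - ln (1 - p n) / p n * \<gamma> n) \<longlonglongrightarrow> 1 * c"
    by (intro tendsto_mult \<gamma>)
  moreover have "\<forall>\<^sub>F n in sequentially. - ln (1 - p n) / p n * \<gamma> n = \<kappa> n"
    using eventually_parameter_bounds by eventually_elim (auto simp: \<gamma>_def \<kappa>_def s_def)
  ultimately show ?thesis
    using tendsto_cong by force
qed

lemma s_eq: "n > 1 \<Longrightarrow> s n * real n = \<kappa> n * ln (real n)"
  by (simp add: \<kappa>_def)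

lemma p_eq: "n > 1 \<Longrightarrow> p n * real n = \<gamma> n * ln (real n)"
  by (simp add: \<gamma>_def)

lemma ln_p: "n > 1 \<Longrightarrow> 0 < \<gamma> n \<Longrightarrow> ln (p n) = ln (\<gamma> n) + ln (ln (real n)) - ln (real n)"
proof -
  assume n: "n > 1" "0 < \<gamma> n"
  then have "p n = \<gamma> n * ln (real n) / real n" by (simp add: \<gamma>_def)
  with n show ?thesis by (simp add: ln_mult ln_div)
qed

text \<open>
  With \<open>x = n\<^bsup>c + \<delta>\<^esup>\<close>, the inequality \<open>exp (s x) - 1 \<ge> s x \<ge> p x\<close> reduces the tail bound to
  \<open>exp (s n) / x = n\<^bsup>\<kappa> - c - \<delta>\<^esup>\<close>.
\<close>

lemma upper_tail_powr:
  assumes "\<delta> > 0"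
  shows "(\<lambda>n. measure_pmf.prob (reach_count n (p n)) {k. real k > real n powr (c + \<delta>)}) \<longlonglongrightarrow> 0"
proof (rule tendsto_0_bound)
  have "(\<lambda>n. \<kappa> n - (c + \<delta>)) \<longlonglongrightarrow> c - (c + \<delta>)"
    by (intro tendsto_intros \<kappa>)
  then show "(\<lambda>n. exp (ln (real n) * (\<kappa> n - (c + \<delta>)))) \<longlonglongrightarrow> 0"
    by (rule exp_ln_mult_tendsto_0) (use assms in simp)
  show "\<forall>\<^sub>F n in sequentially. measure_pmf.prob (reach_count n (p n))
      {k. real k > real n powr (c + \<delta>)} \<le> exp (ln (real n) * (\<kappa> n - (c + \<delta>)))"
    using eventually_parameter_bounds
  proof eventually_elim
    case (elim n)
    define x where "x = real n powr (c + \<delta>)"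
    have x: "x > 0" "x = exp (ln (real n) * (c + \<delta>))"
      using elim by (auto simp: x_def powr_def mult.commute)
    have "measure_pmf.prob (reach_count n (p n)) {k. real k > x} \<le>
        p n * exp (s n * n) / (exp (s n * x) - 1)"
      using elim x unfolding s_def by (intro prob_reach_count_gt) auto
    also have "\<dots> \<le> p n * exp (s n * n) / (p n * x)"
    proof (rule divide_left_mono)
      have "p n * x \<le> s n * x" using elim x by (intro mult_right_mono) auto
      also have "\<dots> \<le> exp (s n * x) - 1" using exp_ge_add_one_self[of "s n * x"] by linarith
      finally show "p n * x \<le> exp (s n * x) - 1" .
      then show "0 < (exp (s n * x) - 1) * (p n * x)"
        using elim x by (smt (verit) mult_pos_pos)
    qed (use elim in auto)
    also have "\<dots> = exp (s n * n) / x" using elim by simp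
    also have "\<dots> = exp (ln (real n) * (\<kappa> n - (c + \<delta>)))"
      unfolding x(2) s_eq[OF conjunct1[OF elim]]
      by (simp add: exp_diff[symmetric] algebra_simps)
    finally show ?case by (simp add: x_def)
  qed
qed simp

text \<open>
  With \<open>x = a n\<close>, where \<open>a = 1 - 1 / c + \<delta>\<close> is positive because of \<open>c \<ge> 1\<close>, the exponential
  \<open>exp (s x)\<close> tends to infinity, and up to a constant factor the tail bound is
  \<open>p exp (s n - s x) = \<gamma> ln n \<cdot> n\<^bsup>\<kappa> (1 - a) - 1\<^esup>\<close>. The exponent tends to \<open>- c \<delta>\<close>.
\<close>

lemma upper_tail_linear:
  assumes "\<delta> > 0" "c \<ge> 1"
  shows "(\<lambda>n. measure_pmf.prob (reach_count n (p n)) {k. real k > (1 - 1 / c + \<delta>) * real n}) \<longlonglongrightarrow> 0"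
proof (rule tendsto_0_bound)
  define a where "a = 1 - 1 / c + \<delta>"
  have a: "a > 0" using assms by (simp add: a_def add_nonneg_pos)
  \<comment> \<open>The last summand absorbs the factor \<open>ln n\<close> of \<open>p = \<gamma> ln n / n\<close>.\<close>
  define b where "b n = \<kappa> n * (1 - a) - 1 + ln (ln (real n)) / ln (real n)" for n
  have "(\<lambda>n. ln (ln (real n)) / ln (real n)) \<longlonglongrightarrow> 0" by real_asymp
  then have "b \<longlonglongrightarrow> c * (1 - a) - 1 + 0"
    unfolding b_def by (intro tendsto_intros \<kappa>)
  moreover have "c * (1 - a) - 1 + 0 < 0"
    using c_pos assms by (simp add: a_def field_simps)
  ultimately have "(\<lambda>n. exp (ln (real n) * b n)) \<longlonglongrightarrow> 0"
    by (rule exp_ln_mult_tendsto_0)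
  then have "(\<lambda>n. 2 * \<gamma> n * exp (ln (real n) * b n)) \<longlonglongrightarrow> 2 * c * 0"
    by (intro tendsto_intros \<gamma>)
  then show "(\<lambda>n. 2 * \<gamma> n * exp (ln (real n) * b n)) \<longlonglongrightarrow> 0" by simp
  have "filterlim (\<lambda>n. ln (real n)) at_top sequentially" by real_asymp
  moreover have "(\<lambda>n. \<kappa> n * a) \<longlonglongrightarrow> c * a" by (intro tendsto_intros \<kappa>)
  ultimately have "filterlim (\<lambda>n. \<kappa> n * a * ln (real n)) at_top sequentially"
    using a c_pos by (intro filterlim_tendsto_pos_mult_at_top[of _ "c * a"]) auto
  then have "\<forall>\<^sub>F n in sequentially. \<kappa> n * a * ln (real n) \<ge> ln 2"
    by (simp add: filterlim_at_top)
  with eventually_parameter_bounds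
  show "\<forall>\<^sub>F n in sequentially. measure_pmf.prob (reach_count n (p n))
      {k. real k > (1 - 1 / c + \<delta>) * real n} \<le> 2 * \<gamma> n * exp (ln (real n) * b n)"
  proof eventually_elim
    case (elim n)
    define x where "x = a * real n"
    have x: "x > 0" "s n * x = \<kappa> n * a * ln (real n)"
      using elim a s_eq[of n] by (auto simp: x_def)
    have ln: "ln (real n) > 0" using elim by simp
    have "exp (ln 2) \<le> exp (s n * x)" using elim x by (simp only: exp_le_cancel_iff)
    then have ge: "exp (s n * x) \<ge> 2" by simp
    have "measure_pmf.prob (reach_count n (p n)) {k. real k > x} \<le>
        p n * exp (s n * n) / (exp (s n * x) - 1)"
      using elim x unfolding s_def by (intro prob_reach_count_gt) auto
    also have "\<dots> \<le> p n * exp (s n * n) / (exp (s n * x) / 2)"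
      using ge elim x(1) by (intro divide_left_mono mult_pos_pos) auto
    also have "\<dots> = 2 * p n * exp (s n * n - s n * x)"
      by (simp add: exp_diff)
    also have "\<dots> = 2 * \<gamma> n * (exp (ln (ln (real n))) * exp (- ln (real n))) * exp (s n * n - s n * x)"
      using elim ln by (simp add: \<gamma>_def exp_minus field_simps)
    also have "\<dots> = 2 * \<gamma> n * exp (ln (ln (real n)) + - ln (real n) + (s n * n - s n * x))"
      by (simp only: exp_add mult.assoc)
    also have "ln (ln (real n)) + - ln (real n) + (s n * n - s n * x) = ln (real n) * b n"
      unfolding x(2) s_eq[OF conjunct1[OF elim(1)]] using ln by (simp add: b_def field_simps)
    finally show ?case by (simp add: x_def a_def)
  qed
qed simp

text \<open>
  With \<open>x = n\<^bsup>c - \<delta>\<^esup>\<close>, the product \<open>s x\<close> tends to \<open>0\<close> because of \<open>c < 1\<close>. For \<open>a = 1 / x\<close> the tail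
  bound is then of the order of the square root of \<open>x exp (- p n) = n\<^bsup>c - \<delta> - \<gamma>\<^esup>\<close>.
\<close>

lemma lower_tail_powr:
  assumes "\<delta> > 0" "c < 1"
  shows "(\<lambda>n. measure_pmf.prob (reach_count n (p n)) {k. real k < real n powr (c - \<delta>)}) \<longlonglongrightarrow> 0"
proof (rule tendsto_0_bound)
  define b where "b n = (\<kappa> n * real n powr (c - \<delta> - 1) - \<gamma> n + (c - \<delta>)) / 2" for n
  have "(\<lambda>n. real n powr (c - \<delta> - 1)) \<longlonglongrightarrow> 0"
    using assms by real_asymp
  then have "b \<longlonglongrightarrow> (c * 0 - c + (c - \<delta>)) / 2"
    unfolding b_def by (intro tendsto_intros \<kappa> \<gamma>) auto
  moreover have "(c * 0 - c + (c - \<delta>)) / 2 < 0" using assms by simp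
  ultimately have "(\<lambda>n. exp (ln (real n) * b n)) \<longlonglongrightarrow> 0"
    by (rule exp_ln_mult_tendsto_0)
  then have "(\<lambda>n. 2 * exp (p n / 2) * exp (ln (real n) * b n)) \<longlonglongrightarrow> 2 * exp (0 / 2) * 0"
    by (intro tendsto_intros p_tendsto_0) auto
  then show "(\<lambda>n. 2 * exp (p n / 2) * exp (ln (real n) * b n)) \<longlonglongrightarrow> 0" by simp
  show "\<forall>\<^sub>F n in sequentially. measure_pmf.prob (reach_count n (p n))
      {k. real k < real n powr (c - \<delta>)} \<le> 2 * exp (p n / 2) * exp (ln (real n) * b n)"
    using eventually_parameter_bounds
  proof eventually_elim
    case (elim n)
    define x where "x = real n powr (c - \<delta>)"
    have x: "x > 0" "ln (1 / x) = - (c - \<delta>) * ln (real n)"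
      using elim by (auto simp: x_def ln_div ln_powr algebra_simps)
    have "x = real n powr (c - \<delta> - 1) * real n"
      using elim by (simp add: x_def powr_diff)
    then have sx: "s n * x = \<kappa> n * real n powr (c - \<delta> - 1) * ln (real n)"
      using s_eq[of n] elim by (simp add: mult_ac)
    have "measure_pmf.prob (reach_count n (p n)) {k. real k < x} \<le>
        2 * exp (p n / 2) * exp ((s n * x - p n * n - ln (1 / x)) / 2)"
      using elim x(1) unfolding s_def by (intro prob_reach_count_lt) auto
    also have "(s n * x - p n * n - ln (1 / x)) / 2 = ln (real n) * b n"
      unfolding sx x(2) using elim p_eq[of n] by (simp add: b_def field_simps)
    finally show ?case by (simp add: x_def)
  qed
qed simp

text \<open>
  Here \<open>1 / p = n\<^bsup>1 - o(1)\<^esup>\<close>, and for \<open>a = p\<close> and \<open>x = (1 - 1 / c - \<delta>) n\<close> the tail bound is of the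
  order of the square root of \<open>exp (s x - p n) / p = n\<^bsup>- c \<delta> + o(1)\<^esup>\<close>.
\<close>

lemma lower_tail_linear:
  assumes "\<delta> > 0"
  shows "(\<lambda>n. measure_pmf.prob (reach_count n (p n)) {k. real k < (1 - 1 / c - \<delta>) * real n}) \<longlonglongrightarrow> 0"
proof (rule tendsto_0_bound)
  define a where "a = 1 - 1 / c - \<delta>"
  define b where "b n = (\<kappa> n * a - \<gamma> n + 1 - ln (ln (real n)) / ln (real n)
    - ln (\<gamma> n) * (1 / ln (real n))) / 2" for n
  have "(\<lambda>n. ln (ln (real n)) / ln (real n)) \<longlonglongrightarrow> 0" "(\<lambda>n. 1 / ln (real n)) \<longlonglongrightarrow> 0"
    by real_asymp+
  moreover have "(\<lambda>n. ln (\<gamma> n)) \<longlonglongrightarrow> ln c"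
    using c_pos by (intro tendsto_ln \<gamma>) simp
  ultimately have "b \<longlonglongrightarrow> (c * a - c + 1 - 0 - ln c * 0) / 2"
    unfolding b_def by (intro tendsto_divide tendsto_diff tendsto_add tendsto_mult tendsto_const \<kappa> \<gamma>) auto
  moreover have "(c * a - c + 1 - 0 - ln c * 0) / 2 < 0"
    using c_pos assms by (simp add: a_def field_simps)
  ultimately have "(\<lambda>n. exp (ln (real n) * b n)) \<longlonglongrightarrow> 0"
    by (rule exp_ln_mult_tendsto_0)
  then have "(\<lambda>n. 2 * exp (p n / 2) * exp (ln (real n) * b n)) \<longlonglongrightarrow> 2 * exp (0 / 2) * 0"
    by (intro tendsto_intros p_tendsto_0) auto
  then show "(\<lambda>n. 2 * exp (p n / 2) * exp (ln (real n) * b n)) \<longlonglongrightarrow> 0" by simp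
  show "\<forall>\<^sub>F n in sequentially. measure_pmf.prob (reach_count n (p n))
      {k. real k < (1 - 1 / c - \<delta>) * real n} \<le> 2 * exp (p n / 2) * exp (ln (real n) * b n)"
    using eventually_parameter_bounds
  proof eventually_elim
    case (elim n)
    have ln: "ln (real n) > 0" using elim by simp
    have sx: "s n * (a * real n) = \<kappa> n * a * ln (real n)"
      using elim s_eq[of n] by simp
    have "measure_pmf.prob (reach_count n (p n)) {k. real k < a * real n} \<le>
        2 * exp (p n / 2) * exp ((s n * (a * real n) - p n * n - ln (p n)) / 2)"
      using elim unfolding s_def by (intro prob_reach_count_lt) auto
    also have "(s n * (a * real n) - p n * n - ln (p n)) / 2 = ln (real n) * b n"
      unfolding sx p_eq[OF conjunct1[OF elim]] using elim ln by (simp add: ln_p b_def field_simps)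
    finally show ?case by (simp add: a_def)
  qed
qed simp

end

section \<open>From fixed to vanishing slack\<close>

text \<open>
  The infimum of the slacks \<open>d\<close> that succeed with probability at least \<open>1 - d\<close> tends to \<open>0\<close>, because
  each fixed slack is eventually among them. Adding \<open>1 / (n + 1)\<close> moves strictly above the infimum,
  so that the success probability is still controlled although the infimum need not be attained.
\<close>

lemma exists_vanishing_slack:
  fixes F :: "nat \<Rightarrow> real \<Rightarrow> real"
  assumes mono: "\<And>n d d'. d \<le> d' \<Longrightarrow> F n d \<le> F n d'"
    and range: "\<And>n d. 0 \<le> F n d" "\<And>n d. F n d \<le> 1"
    and lim: "\<And>d. d > 0 \<Longrightarrow> (\<lambda>n. F n d) \<longlonglongrightarrow> 1"
  shows "\<exists>\<epsilon>. \<epsilon> \<longlonglongrightarrow> 0 \<and> (\<lambda>n. F n (\<epsilon> n)) \<longlonglongrightarrow> 1"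
proof -
  define D where "D n = {d. d > 0 \<and> F n d \<ge> 1 - d}" for n
  define \<epsilon> where "\<epsilon> n = Inf (D n) + 1 / real (Suc n)" for n
  have D: "D n \<noteq> {}" "bdd_below (D n)" for n
  proof -
    have "1 \<in> D n" using range by (simp add: D_def)
    then show "D n \<noteq> {}" by blast
    show "bdd_below (D n)" by (rule bdd_belowI[of _ 0]) (simp add: D_def)
  qed
  have Inf: "Inf (D n) \<ge> 0" for n
    using D by (intro cInf_greatest) (auto simp: D_def)
  have "(\<lambda>n. Inf (D n)) \<longlonglongrightarrow> 0"
  proof (rule order_tendstoI)
    fix a :: real assume "a > 0"
    then have "a / 2 > 0" by simp
    from order_tendstoD(1)[OF lim[OF this], of "1 - a / 2"] \<open>a > 0\<close>
    have "\<forall>\<^sub>F n in sequentially. F n (a / 2) > 1 - a / 2" by simp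
    then show "\<forall>\<^sub>F n in sequentially. Inf (D n) < a"
    proof eventually_elim
      case (elim n)
      then have "a / 2 \<in> D n" using \<open>a > 0\<close> by (simp add: D_def)
      then have "Inf (D n) \<le> a / 2" using D by (intro cInf_lower)
      then show ?case using \<open>a > 0\<close> by simp
    qed
  next
    fix a :: real assume "a < 0"
    then show "\<forall>\<^sub>F n in sequentially. a < Inf (D n)"
      using Inf by (intro always_eventually allI) (auto intro: less_le_trans)
  qed
  from tendsto_add[OF this LIMSEQ_Suc[OF lim_1_over_n]] have \<epsilon>: "\<epsilon> \<longlonglongrightarrow> 0"
    by (simp add: \<epsilon>_def[abs_def])
  have lower: "1 - \<epsilon> n \<le> F n (\<epsilon> n)" for n
  proof -
    have "Inf (D n) < \<epsilon> n" by (simp add: \<epsilon>_def)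
    then obtain d where d: "d \<in> D n" "d < \<epsilon> n"
      using D by (auto simp: cInf_less_iff)
    then have "1 - \<epsilon> n \<le> F n d" by (simp add: D_def)
    also have "\<dots> \<le> F n (\<epsilon> n)" using d by (intro mono) simp
    finally show ?thesis .
  qed
  have "(\<lambda>n. 1 - \<epsilon> n) \<longlonglongrightarrow> 1"
    using tendsto_diff[OF tendsto_const \<epsilon>, of 1] by simp
  then have "(\<lambda>n. F n (\<epsilon> n)) \<longlonglongrightarrow> 1"
    by (rule tendsto_sandwich[OF always_eventually[OF allI[OF lower]]
        always_eventually[OF allI[OF range(2)]] _ tendsto_const])
  with \<epsilon> show ?thesis by blast
qed

text \<open>
  \<open>L\<close> and \<open>U\<close> are the lower and the upper tail event for the property \<open>Q\<close>. One-sided properties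
  are covered by taking one of them to be false.
\<close>

lemma aas_reach_countI:
  fixes Q :: "nat \<Rightarrow> real \<Rightarrow> nat \<Rightarrow> bool"
  assumes mono: "\<And>n d d' k. d \<le> d' \<Longrightarrow> Q n d k \<Longrightarrow> Q n d' k"
    and cover: "\<And>n d k. d > 0 \<Longrightarrow> \<not> Q n d k \<Longrightarrow> L n d k \<or> U n d k"
    and L: "\<And>d. d > 0 \<Longrightarrow> (\<lambda>n. measure_pmf.prob (reach_count n (p n)) {k. L n d k}) \<longlonglongrightarrow> 0"
    and U: "\<And>d. d > 0 \<Longrightarrow> (\<lambda>n. measure_pmf.prob (reach_count n (p n)) {k. U n d k}) \<longlonglongrightarrow> 0"
  shows "\<exists>\<epsilon>. \<epsilon> \<longlonglongrightarrow> 0 \<and>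
    aas (\<lambda>n. random_ordered_digraph n (p n)) (\<lambda>n G. Q n (\<epsilon> n) (card (reachable_set G 1)))"
proof -
  define F where "F n d = measure_pmf.prob (reach_count n (p n)) {k. Q n d k}" for n d
  have "\<exists>\<epsilon>. \<epsilon> \<longlonglongrightarrow> 0 \<and> (\<lambda>n. F n (\<epsilon> n)) \<longlonglongrightarrow> 1"
  proof (rule exists_vanishing_slack)
    fix n and d d' :: real assume "d \<le> d'"
    then show "F n d \<le> F n d'"
      unfolding F_def by (intro measure_pmf.finite_measure_mono) (auto intro: mono)
  next
    fix d :: real assume d: "d > 0"
    define B where "B n = measure_pmf.prob (reach_count n (p n)) {k. L n d k} +
      measure_pmf.prob (reach_count n (p n)) {k. U n d k}" for n
    have "(\<lambda>n. 1 - B n) \<longlonglongrightarrow> 1 - (0 + 0)"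
      unfolding B_def by (intro tendsto_intros L U d)
    then have lim: "(\<lambda>n. 1 - B n) \<longlonglongrightarrow> 1" by simp
    have lower: "1 - B n \<le> F n d" for n
    proof -
      have "1 - F n d = measure_pmf.prob (reach_count n (p n)) {k. \<not> Q n d k}"
        unfolding F_def by (subst measure_pmf.prob_compl[symmetric]) (auto intro: arg_cong2[of _ _ _ _ measure])
      also have "\<dots> \<le> measure_pmf.prob (reach_count n (p n)) ({k. L n d k} \<union> {k. U n d k})"
        using cover[OF d] by (intro measure_pmf.finite_measure_mono) auto
      also have "\<dots> \<le> B n" unfolding B_def by (intro measure_Un_le) auto
      finally show ?thesis by simp
    qed
    have upper: "F n d \<le> 1" for n by (simp add: F_def)
    show "(\<lambda>n. F n d) \<longlonglongrightarrow> 1"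
      by (rule tendsto_sandwich[OF always_eventually[OF allI[OF lower]]
          always_eventually[OF allI[OF upper]] lim tendsto_const])
  qed (auto simp: F_def)
  then show ?thesis
    unfolding aas_def F_def reach_count_def measure_map_pmf vimage_def mem_Collect_eq .
qed

theorem theorem1:
  fixes c :: real and \<xi> p :: "nat \<Rightarrow> real"
  assumes c_pos: "c > 0"
    and xi: "\<xi> \<in> o(\<lambda>n. ln (real n) / real n)"
    and p: "\<And>n. p n = c * ln (real n) / real n + \<xi> n"
  shows
    "(c < 1 \<longrightarrow> (\<exists>\<epsilon> :: nat \<Rightarrow> real. \<epsilon> \<longlonglongrightarrow> 0 \<and>
        aas (\<lambda>n. random_ordered_digraph n (p n))
          (\<lambda>n G. real n powr (c - \<epsilon> n) \<le> real (card (reachable_set G 1)) \<and>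
                 real (card (reachable_set G 1)) \<le> real n powr (c + \<epsilon> n)))) \<and>
     (c = 1 \<longrightarrow> (\<exists>\<epsilon> :: nat \<Rightarrow> real. \<epsilon> \<longlonglongrightarrow> 0 \<and>
        aas (\<lambda>n. random_ordered_digraph n (p n))
          (\<lambda>n G. real (card (reachable_set G 1)) \<le> \<epsilon> n * real n))) \<and>
     (c > 1 \<longrightarrow> (\<exists>\<epsilon> :: nat \<Rightarrow> real. \<epsilon> \<longlonglongrightarrow> 0 \<and>
        aas (\<lambda>n. random_ordered_digraph n (p n))
          (\<lambda>n G. \<bar>real (card (reachable_set G 1)) - (1 - 1 / c) * real n\<bar> \<le> \<epsilon> n * real n)))"
proof -
  interpret edge_probability p c
  proof
    have "(\<lambda>n. \<xi> n / (ln (real n) / real n)) \<longlonglongrightarrow> 0"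
      using xi by (rule smalloD_tendsto)
    then have "(\<lambda>n. c + \<xi> n / (ln (real n) / real n)) \<longlonglongrightarrow> c + 0"
      by (intro tendsto_intros)
    moreover have "\<forall>\<^sub>F n in sequentially.
        c + \<xi> n / (ln (real n) / real n) = p n * real n / ln (real n)"
      using eventually_gt_at_top[of 1] by eventually_elim (simp add: p field_simps)
    ultimately show "(\<lambda>n. p n * real n / ln (real n)) \<longlonglongrightarrow> c"
      using tendsto_cong by force
  qed fact
  have powr_mono: "real n powr x \<le> real n powr y" if "x \<le> y" for n x y
    using that by (cases "n = 0") (auto intro: powr_mono)
  show ?thesis
  proof (intro conjI impI)
    assume "c < 1"
    show "\<exists>\<epsilon> :: nat \<Rightarrow> real. \<epsilon> \<longlonglongrightarrow> 0 \<and>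
        aas (\<lambda>n. random_ordered_digraph n (p n))
          (\<lambda>n G. real n powr (c - \<epsilon> n) \<le> real (card (reachable_set G 1)) \<and>
                 real (card (reachable_set G 1)) \<le> real n powr (c + \<epsilon> n))"
    proof (rule aas_reach_countI[where L = "\<lambda>n d k. real k < real n powr (c - d)"
          and U = "\<lambda>n d k. real k > real n powr (c + d)"])
      fix n k and d d' :: real
      assume "d \<le> d'" "real n powr (c - d) \<le> real k \<and> real k \<le> real n powr (c + d)"
      then show "real n powr (c - d') \<le> real k \<and> real k \<le> real n powr (c + d')"
        using powr_mono[of "c - d'" "c - d" n] powr_mono[of "c + d" "c + d'" n] by linarith
    qed (use lower_tail_powr \<open>c < 1\<close> upper_tail_powr in auto)
  next
    assume "c = 1"
    show "\<exists>\<epsilon> :: nat \<Rightarrow> real. \<epsilon> \<longlonglongrightarrow> 0 \<and>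
        aas (\<lambda>n. random_ordered_digraph n (p n))
          (\<lambda>n G. real (card (reachable_set G 1)) \<le> \<epsilon> n * real n)"
    proof (rule aas_reach_countI[where L = "\<lambda>_ _ _. False"
          and U = "\<lambda>n d k. real k > d * real n"])
      fix n k and d d' :: real
      assume "d \<le> d'" "real k \<le> d * real n"
      then show "real k \<le> d' * real n"
        using mult_right_mono[of d d' "real n"] by linarith
    qed (use upper_tail_linear \<open>c = 1\<close> in auto)
  next
    assume "c > 1"
    show "\<exists>\<epsilon> :: nat \<Rightarrow> real. \<epsilon> \<longlonglongrightarrow> 0 \<and>
        aas (\<lambda>n. random_ordered_digraph n (p n))
          (\<lambda>n G. \<bar>real (card (reachable_set G 1)) - (1 - 1 / c) * real n\<bar> \<le> \<epsilon> n * real n)"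
    proof (rule aas_reach_countI[where L = "\<lambda>n d k. real k < (1 - 1 / c - d) * real n"
          and U = "\<lambda>n d k. real k > (1 - 1 / c + d) * real n"])
      fix n k and d d' :: real
      assume "d \<le> d'" "\<bar>real k - (1 - 1 / c) * real n\<bar> \<le> d * real n"
      then show "\<bar>real k - (1 - 1 / c) * real n\<bar> \<le> d' * real n"
        using mult_right_mono[of d d' "real n"] by linarith
    next
      fix n k and d :: real
      assume "\<not> \<bar>real k - (1 - 1 / c) * real n\<bar> \<le> d * real n"
      then show "real k < (1 - 1 / c - d) * real n \<or> real k > (1 - 1 / c + d) * real n"
        by (auto simp: algebra_simps)
    qed (use lower_tail_linear upper_tail_linear \<open>c > 1\<close> in auto)
  qed
qed

end
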